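(* For each $r\in\{1,2,3\}$ there exist graphs $G_r$ and $H_r$ with $\omega^{(r)}(G_r)=\omega^{(r)}(H_r)$ but $\omega^{(r+1)}(G_r)\ne\omega^{(r+1)}(H_r)$. Hence $\omega^{(1)}$, $\omega^{(2)}$, $\omega^{(3)}$ are strictly weaker than $\omega^{(2)}$, $\omega^{(3)}$, $\omega^{(4)}$ respectively.
   Context: Graphs are finite, simple and undirected; an $N$-vertex graph has $V(G)=\{1,\dots,N\}$. Let $w_k(x,y)$ be the number of walks of length $k$ from $x$ to $y$, $w_*(x,y)=(w_0(x,y),\dots,w_{N-1}(x,y))$. Define $\omega_0(x)=w_*(x,x)$, $\omega_{r+1}(x)=\big(\omega_r(x),\{\!\{(w_*(x,y),\omega_r(y))\}\!\}_{y\in V(G)}\big)$, where $\{\!\{\cdot\}\!\}$ denotes a multiset, and $\omega^{(r)}(G)=\{\!\{\omega_r(x)\}\!\}_{x\in V(G)}$. *)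

theory Defs
  imports Main "HOL-Library.Multiset"
begin

definition simple_graph :: "nat \<Rightarrow> (nat \<Rightarrow> nat \<Rightarrow> bool) \<Rightarrow> bool" where
  "simple_graph N E \<longleftrightarrow>
     (\<forall>x y. E x y \<longrightarrow> x \<in> {1..N} \<and> y \<in> {1..N}) \<and>
     (\<forall>x y. E x y \<longrightarrow> E y x) \<and> (\<forall>x. \<not> E x x)"

fun walks :: "nat \<Rightarrow> (nat \<Rightarrow> nat \<Rightarrow> bool) \<Rightarrow> nat \<Rightarrow> nat \<Rightarrow> nat \<Rightarrow> nat" where
  "walks N E 0 x y = (if x = y then 1 else 0)"
| "walks N E (Suc k) x y = (\<Sum>z\<in>{1..N}. if E x z then walks N E k z y else 0)"

definition wstar :: "nat \<Rightarrow> (nat \<Rightarrow> nat \<Rightarrow> bool) \<Rightarrow> nat \<Rightarrow> nat \<Rightarrow> nat list" where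
  "wstar N E x y = map (\<lambda>k. walks N E k x y) [0..<N]"

datatype wcol = W0 "nat list" | WS wcol "(nat list \<times> wcol) multiset"

fun omega_v :: "nat \<Rightarrow> nat \<Rightarrow> (nat \<Rightarrow> nat \<Rightarrow> bool) \<Rightarrow> nat \<Rightarrow> wcol" where
  "omega_v 0 N E x = W0 (wstar N E x x)"
| "omega_v (Suc r) N E x =
     WS (omega_v r N E x)
        (image_mset (\<lambda>y. (wstar N E x y, omega_v r N E y)) (mset_set {1..N}))"

definition omega :: "nat \<Rightarrow> nat \<Rightarrow> (nat \<Rightarrow> nat \<Rightarrow> bool) \<Rightarrow> wcol multiset" where
  "omega r N E = image_mset (omega_v r N E) (mset_set {1..N})"

end

theory Submission
  imports Defs
begin

text \<open>
  The separating graphs are Cai--Fuerer--Immerman gadgets along a path of \<open>2r + 2\<close> fibres, each a copy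
  of \<open>(\<int>/2)\<^sup>2\<close> with elements \<open>(p, q)\<close>. The coordinate \<open>q\<close> of a fibre is joined to the coordinate
  \<open>p\<close> of the next one, the value of \<open>p + q\<close> is made visible in every fibre, and the outer coordinates
  of the two end fibres are visible as well. The second graph twists the middle link.

  The link between two consecutive fibres acts on the characters \<open>(-1)\<^sup>q\<close> and \<open>(-1)\<^sup>p\<close> of its ends,
  whose span is an invariant subspace of the adjacency matrix. A twist is thus a rank-two
  perturbation inside that subspace and changes the number of walks between two vertices only if they
  lie at the two ends of the twisted link. Multiplying characters inside a fibre, that is passing
  from \<open>(-1)\<^sup>p\<close> to \<open>(-1)\<^sup>q\<close>, is not linear and takes one refinement round. So the information
  entering at the two ends of the path advances by one fibre per round, and the two fronts
  meet at the twisted link in round \<open>r + 1\<close>, not earlier.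
\<close>

declare sum_of_bool_mult_eq [simp del] sum_mult_of_bool_eq [simp del] sum_of_bool_eq [simp del]
  add_2_eq_Suc [simp del] add_2_eq_Suc' [simp del]

section \<open>Walk refinement on an arbitrary vertex type and its invariance under
  isomorphism\<close>

primrec walks_on :: "'a set \<Rightarrow> ('a \<Rightarrow> 'a \<Rightarrow> bool) \<Rightarrow> nat \<Rightarrow> 'a \<Rightarrow> 'a \<Rightarrow> nat" where
  "walks_on V R 0 x y = (if x = y then 1 else 0)"
| "walks_on V R (Suc k) x y = (\<Sum>z\<in>V. if R x z then walks_on V R k z y else 0)"

definition wstar_on :: "'a set \<Rightarrow> ('a \<Rightarrow> 'a \<Rightarrow> bool) \<Rightarrow> 'a \<Rightarrow> 'a \<Rightarrow> nat list" where
  "wstar_on V R x y = map (\<lambda>k. walks_on V R k x y) [0..<card V]"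

primrec omega_on :: "nat \<Rightarrow> 'a set \<Rightarrow> ('a \<Rightarrow> 'a \<Rightarrow> bool) \<Rightarrow> 'a \<Rightarrow> wcol" where
  "omega_on 0 V R x = W0 (wstar_on V R x x)"
| "omega_on (Suc r) V R x =
     WS (omega_on r V R x)
        (image_mset (\<lambda>y. (wstar_on V R x y, omega_on r V R y)) (mset_set V))"

lemma walks_eq_walks_on: "walks N E k x y = walks_on {1..N} E k x y"
  by (induction k arbitrary: x) (simp_all cong: if_cong)

lemma omega_v_eq_omega_on: "omega_v r N E x = omega_on r {1..N} E x"
proof -
  have "wstar N E = wstar_on {1..N} E"
    by (intro ext) (simp add: wstar_def wstar_on_def walks_eq_walks_on)
  then show ?thesis
    by (induction r arbitrary: x) simp_all
qed

lemma image_mset_bij: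
  assumes "bij_betw \<sigma> V V'" and "\<And>y. y \<in> V \<Longrightarrow> h y = h' (\<sigma> y)"
  shows "image_mset h (mset_set V) = image_mset h' (mset_set V')"
proof (cases "finite V")
  case True
  have "mset_set V' = image_mset \<sigma> (mset_set V)"
    using assms(1) by (simp add: image_mset_mset_set bij_betw_def)
  then show ?thesis
    using True assms(2) by (auto simp: multiset.map_comp intro!: image_mset_cong)
next
  case False
  then have "infinite V'"
    using assms(1) bij_betw_finite by blast
  with False show ?thesis by simp
qed

lemma walks_on_iso:
  assumes \<sigma>: "bij_betw \<sigma> V V'"
    and R: "\<And>x y. x \<in> V \<Longrightarrow> y \<in> V \<Longrightarrow> R x y \<longleftrightarrow> R' (\<sigma> x) (\<sigma> y)"
    and "x \<in> V" "y \<in> V"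
  shows "walks_on V' R' k (\<sigma> x) (\<sigma> y) = walks_on V R k x y"
  using assms(3)
proof (induction k arbitrary: x)
  case 0
  then show ?case
    using \<sigma> \<open>y \<in> V\<close> by (auto simp: bij_betw_def inj_on_def)
next
  case (Suc k)
  have "walks_on V' R' (Suc k) (\<sigma> x) (\<sigma> y)
      = (\<Sum>z\<in>V. if R' (\<sigma> x) (\<sigma> z) then walks_on V' R' k (\<sigma> z) (\<sigma> y) else 0)"
    using sum.reindex_bij_betw[OF \<sigma>, symmetric] by simp
  also have "\<dots> = walks_on V R (Suc k) x y"
    using R Suc by (auto intro!: sum.cong)
  finally show ?case .
qed

lemma omega_on_iso:
  assumes \<sigma>: "bij_betw \<sigma> V V'"
    and R: "\<And>x y. x \<in> V \<Longrightarrow> y \<in> V \<Longrightarrow> R x y \<longleftrightarrow> R' (\<sigma> x) (\<sigma> y)"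
    and "x \<in> V"
  shows "omega_on r V R x = omega_on r V' R' (\<sigma> x)"
proof -
  have w: "wstar_on V R x y = wstar_on V' R' (\<sigma> x) (\<sigma> y)" if "x \<in> V" "y \<in> V" for x y
    using walks_on_iso[where R = R and R' = R', OF \<sigma> R that] bij_betw_same_card[OF \<sigma>]
    by (simp add: wstar_on_def)
  show ?thesis
    using \<open>x \<in> V\<close>
  proof (induction r arbitrary: x)
    case 0
    then show ?case by (simp add: w)
  next
    case (Suc r)
    then show ?case by (auto simp: w intro!: image_mset_bij[OF \<sigma>])
  qed
qed

text \<open>Pulling back along an enumeration of \<open>V\<close> is an isomorphism, so the gadgets
  can live on a structured vertex type and be numbered only at the end.\<close>

lemma omega_on_realised:
  fixes V :: "'a set"
  assumes "finite V" and "symp R" and "irreflp R" and "symp R'" and "irreflp R'"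
  obtains E F where "simple_graph (card V) E" and "simple_graph (card V) F"
    and "\<And>r. omega r (card V) E = image_mset (omega_on r V R) (mset_set V)"
    and "\<And>r. omega r (card V) F = image_mset (omega_on r V R') (mset_set V)"
proof -
  obtain d where d: "bij_betw d {1..card V} V"
    using ex_bij_betw_nat_finite_1[OF \<open>finite V\<close>] by blast
  define pull where
    "pull Q x y \<longleftrightarrow> x \<in> {1..card V} \<and> y \<in> {1..card V} \<and> Q (d x) (d y)" for Q :: "'a \<Rightarrow> 'a \<Rightarrow> bool" and x y
  have "omega r (card V) (pull Q) = image_mset (omega_on r V Q) (mset_set V)" for Q r
    unfolding omega_def omega_v_eq_omega_on
    by (intro image_mset_bij[OF d] omega_on_iso[OF d]) (auto simp: pull_def)
  moreover have "simple_graph (card V) (pull Q)" if "symp Q" "irreflp Q" for Q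
    using that by (auto simp: simple_graph_def pull_def dest: sympD irreflpD)
  ultimately show ?thesis
    using assms that by blast
qed

text \<open>A colour of round \<open>Suc r\<close> stores the colour of round \<open>r\<close> as
  its first component, so the coarser multiset is an image of the finer one.\<close>

lemma omega_Suc_eqD:
  assumes "omega (Suc r) N E = omega (Suc r) M F"
  shows "omega r N E = omega r M F"
proof -
  define prev where "prev c = (case c of W0 l \<Rightarrow> W0 l | WS c' M \<Rightarrow> c')" for c
  have "omega r N E = image_mset prev (omega (Suc r) N E)" for N E
    by (simp add: omega_def multiset.map_comp comp_def prev_def)
  with assms show ?thesis by metis
qed

subsection \<open>Walks under a rank-two switching\<close>

lemma walks_on_int_Suc:
  "int (walks_on V R (Suc k) x y) = (\<Sum>z\<in>V. of_bool (R x z) * int (walks_on V R k z y))"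
  by (auto intro!: sum.cong)

text \<open>The adjacency matrix swaps \<open>f\<close> and \<open>g\<close> up to the factor 2, and
  by symmetry it can be moved from the walk counts onto them.\<close>

lemma sum_times_walks_on:
  fixes f g :: "'a \<Rightarrow> int"
  assumes "finite V" and "symp R"
    and f: "\<And>x. x \<in> V \<Longrightarrow> (\<Sum>z\<in>V. of_bool (R x z) * f z) = 2 * g x"
    and g: "\<And>x. x \<in> V \<Longrightarrow> (\<Sum>z\<in>V. of_bool (R x z) * g z) = 2 * f x"
    and y: "y \<in> V"
  shows "(\<Sum>z\<in>V. f z * int (walks_on V R k z y)) = 2 ^ k * (if even k then f y else g y)
       \<and> (\<Sum>z\<in>V. g z * int (walks_on V R k z y)) = 2 ^ k * (if even k then g y else f y)"
proof (induction k)
  case 0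
  show ?case using y \<open>finite V\<close> by (simp add: if_distrib sum.delta cong: if_cong)
next
  case (Suc k)
  have step: "(\<Sum>z\<in>V. h z * int (walks_on V R (Suc k) z y))
      = 2 * (\<Sum>u\<in>V. h' u * int (walks_on V R k u y))"
    if h: "\<And>x. x \<in> V \<Longrightarrow> (\<Sum>z\<in>V. of_bool (R x z) * h z) = 2 * h' x" for h h' :: "'a \<Rightarrow> int"
  proof -
    have "(\<Sum>z\<in>V. h z * int (walks_on V R (Suc k) z y))
        = (\<Sum>z\<in>V. \<Sum>u\<in>V. h z * of_bool (R z u) * int (walks_on V R k u y))"
      by (simp only: walks_on_int_Suc sum_distrib_left mult.assoc)
    also have "\<dots> = (\<Sum>u\<in>V. \<Sum>z\<in>V. h z * of_bool (R z u) * int (walks_on V R k u y))"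
      by (rule sum.swap)
    also have "\<dots> = (\<Sum>u\<in>V. (\<Sum>z\<in>V. of_bool (R u z) * h z) * int (walks_on V R k u y))"
      unfolding sum_distrib_right using \<open>symp R\<close>
      by (intro sum.cong refl) (auto dest: sympD)
    also have "\<dots> = 2 * (\<Sum>u\<in>V. h' u * int (walks_on V R k u y))"
      by (simp add: h sum_distrib_left mult.assoc)
    finally show ?thesis .
  qed
  show ?case
    using step[OF f] step[OF g] Suc by (simp del: walks_on.simps)
qed

text \<open>The new adjacency matrix is the negative of the old one on the span of \<open>f\<close>
  and \<open>g\<close> and agrees with it on the orthogonal complement. So even powers coincide, and
  odd powers differ by twice the part acting on that span.\<close>

lemma walks_on_switching:
  fixes f g :: "'a \<Rightarrow> int"
  assumes "finite V" and "symp R"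
    and f: "\<And>x. x \<in> V \<Longrightarrow> (\<Sum>z\<in>V. of_bool (R x z) * f z) = 2 * g x"
    and g: "\<And>x. x \<in> V \<Longrightarrow> (\<Sum>z\<in>V. of_bool (R x z) * g z) = 2 * f x"
    and ff: "(\<Sum>z\<in>V. f z * f z) = 4" and gg: "(\<Sum>z\<in>V. g z * g z) = 4"
    and fg: "(\<Sum>z\<in>V. f z * g z) = 0"
    and R': "\<And>x z. x \<in> V \<Longrightarrow> z \<in> V \<Longrightarrow>
      (of_bool (R' x z) :: int) = of_bool (R x z) - (f x * g z + g x * f z)"
    and "x \<in> V" and y: "y \<in> V"
  shows "int (walks_on V R' k x y)
       = int (walks_on V R k x y) - (if odd k then 2 ^ (k - 1) * (f x * g y + g x * f y) else 0)"
  using \<open>x \<in> V\<close>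
proof (induction k arbitrary: x)
  case 0
  show ?case by simp
next
  case (Suc k)
  define w where "w z = int (walks_on V R k z y)" for z
  define c :: int where "c = (if odd k then 2 ^ (k - 1) else 0)"
  have fw: "(\<Sum>z\<in>V. f z * w z) = 2 ^ k * (if even k then f y else g y)"
    and gw: "(\<Sum>z\<in>V. g z * w z) = 2 ^ k * (if even k then g y else f y)"
    using sum_times_walks_on[OF assms(1-4) y] unfolding w_def by blast+
  have "int (walks_on V R' (Suc k) x y)
      = (\<Sum>z\<in>V. (of_bool (R x z) - (f x * g z + g x * f z)) * (w z - c * (f z * g y + g z * f y)))"
    unfolding walks_on_int_Suc using Suc by (intro sum.cong) (auto simp: R' w_def c_def)
  also have "\<dots> = (\<Sum>z\<in>V. of_bool (R x z) * w z)
      - f x * (\<Sum>z\<in>V. g z * w z) - g x * (\<Sum>z\<in>V. f z * w z)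
      - c * g y * (\<Sum>z\<in>V. of_bool (R x z) * f z) - c * f y * (\<Sum>z\<in>V. of_bool (R x z) * g z)
      + c * f x * g y * (\<Sum>z\<in>V. f z * g z) + c * f x * f y * (\<Sum>z\<in>V. g z * g z)
      + c * g x * g y * (\<Sum>z\<in>V. f z * f z) + c * g x * f y * (\<Sum>z\<in>V. f z * g z)"
    unfolding sum_distrib_left sum_subtractf[symmetric] sum.distrib[symmetric]
    by (intro sum.cong refl) (simp add: algebra_simps)
  also have "\<dots> = int (walks_on V R (Suc k) x y)
      - f x * (2 ^ k * (if even k then g y else f y)) - g x * (2 ^ k * (if even k then f y else g y))
      - c * 2 * (g x * g y + f x * f y) + c * 4 * (f x * f y + g x * g y)"
    unfolding f[OF Suc.prems] g[OF Suc.prems] ff gg fg fw gw walks_on_int_Suc w_def[symmetric]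
    by (simp add: algebra_simps)
  also have "\<dots> = int (walks_on V R (Suc k) x y)
      - (if odd (Suc k) then 2 ^ (Suc k - 1) * (f x * g y + g x * f y) else 0)"
  proof (cases "even k")
    case True
    then show ?thesis by (simp add: c_def algebra_simps del: walks_on.simps)
  next
    \<comment> \<open>For odd \<open>k\<close>, \<open>2 * c = 2 ^ k\<close> makes all correction
      terms cancel.\<close>
    case False
    then obtain i where "k = Suc i" by (metis even_zero not0_implies_Suc)
    with False show ?thesis by (simp add: c_def algebra_simps del: walks_on.simps)
  qed
  finally show ?case .
qed

subsection \<open>The twisted caterpillars\<close>

text \<open>
  \<open>S\<close> marks the outer coordinates of the end fibres and \<open>T\<close> marks \<open>p \<noteq> q\<close>. The vertex \<open>Z\<close> only
  adjusts degrees: end fibres have degrees 2, 3, 4, inner fibres 5 or 6, and the hubs at least 5.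
  The set \<open>X\<close> contains \<open>j\<close> if the link between the fibres \<open>j\<close> and \<open>j + 1\<close> is twisted.
\<close>

datatype vertex = P nat bool bool | S | T | Z

fun adj :: "nat \<Rightarrow> nat set \<Rightarrow> vertex \<Rightarrow> vertex \<Rightarrow> bool" where
  "adj n X (P j p q) (P j' p' q') \<longleftrightarrow>
     j' = Suc j \<and> (q = p') \<noteq> (j \<in> X) \<or> j = Suc j' \<and> (q' = p) \<noteq> (j' \<in> X)"
| "adj n X (P j p q) S \<longleftrightarrow> j = 0 \<and> p \<or> Suc j = n \<and> q"
| "adj n X S (P j p q) \<longleftrightarrow> j = 0 \<and> p \<or> Suc j = n \<and> q"
| "adj n X (P j p q) T \<longleftrightarrow> p \<noteq> q"
| "adj n X T (P j p q) \<longleftrightarrow> p \<noteq> q"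
| "adj n X (P j p q) Z \<longleftrightarrow> 0 < j \<and> Suc j < n"
| "adj n X Z (P j p q) \<longleftrightarrow> 0 < j \<and> Suc j < n"
| "adj n X S Z \<longleftrightarrow> True"
| "adj n X Z S \<longleftrightarrow> True"
| "adj n X _ _ \<longleftrightarrow> False"

definition verts :: "nat \<Rightarrow> vertex set" where
  "verts n = {S, T, Z} \<union> (\<lambda>(j, p, q). P j p q) ` ({..<n} \<times> UNIV)"

lemma verts_simps [simp]:
  "P j p q \<in> verts n \<longleftrightarrow> j < n" "S \<in> verts n" "T \<in> verts n" "Z \<in> verts n"
  by (auto simp: verts_def image_iff)

lemma finite_verts [simp]: "finite (verts n)"
  by (simp add: verts_def)

lemma card_verts: "card (verts n) = 4 * n + 3"
proof -
  have "card ((\<lambda>(j, p, q). P j p q) ` ({..<n} \<times> UNIV)) = 4 * n"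
    by (subst card_image) (auto simp: inj_on_def card_cartesian_product simp flip: UNIV_Times_UNIV)
  then show ?thesis
    unfolding verts_def by (subst card_Un_disjoint) auto
qed

lemma symp_adj: "symp (adj n X)"
proof (rule sympI)
  fix x y assume "adj n X x y"
  then show "adj n X y x" by (cases x; cases y) auto
qed

lemma irreflp_adj: "irreflp (adj n X)"
proof (rule irreflpI)
  fix x show "\<not> adj n X x x" by (cases x) auto
qed

lemma sum_verts:
  fixes h :: "vertex \<Rightarrow> int"
  shows "sum h (verts n) = h S + h T + h Z
    + (\<Sum>j<n. h (P j False False) + h (P j False True) + h (P j True False) + h (P j True True))"
proof -
  have inj: "inj_on (\<lambda>(j, p, q). P j p q) ({..<n} \<times> UNIV)" by (auto simp: inj_on_def)
  have "sum h (verts n) = sum h {S, T, Z} + sum h ((\<lambda>(j, p, q). P j p q) ` ({..<n} \<times> UNIV))"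
    unfolding verts_def by (rule sum.union_disjoint) auto
  also have "sum h ((\<lambda>(j, p, q). P j p q) ` ({..<n} \<times> UNIV)) = (\<Sum>(j, p, q)\<in>{..<n} \<times> UNIV. h (P j p q))"
    by (subst sum.reindex[OF inj]) (simp add: case_prod_unfold comp_def)
  also have "\<dots> = (\<Sum>j<n. \<Sum>p\<in>UNIV. \<Sum>q\<in>UNIV. h (P j p q))"
    by (simp add: sum.cartesian_product)
  finally show ?thesis
    by (simp add: UNIV_bool algebra_simps sum.distrib)
qed

section \<open>Characters at the two ends of a link\<close>

abbreviation sgn_of :: "bool \<Rightarrow> int" where
  "sgn_of p \<equiv> (if p then -1 else 1)"

fun left_end :: "nat \<Rightarrow> vertex \<Rightarrow> int" where
  "left_end e (P j p q) = (if j = e then sgn_of q else 0)"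
| "left_end e _ = 0"

fun right_end :: "nat \<Rightarrow> vertex \<Rightarrow> int" where
  "right_end e (P j p q) = (if j = Suc e then sgn_of p else 0)"
| "right_end e _ = 0"

lemma sum_fibre:
  fixes h :: "vertex \<Rightarrow> int"
  assumes "h S = 0" "h T = 0" "h Z = 0" "\<And>j p q. j \<noteq> e \<Longrightarrow> h (P j p q) = 0" and "e < n"
  shows "sum h (verts n) = h (P e False False) + h (P e False True) + h (P e True False) + h (P e True True)"
proof -
  have "(\<Sum>j<n. h (P j False False) + h (P j False True) + h (P j True False) + h (P j True True))
      = (\<Sum>j<n. if j = e then h (P j False False) + h (P j False True) + h (P j True False) + h (P j True True) else 0)"
    using assms by (intro sum.cong) auto
  with assms show ?thesis by (simp add: sum_verts)
qed

text \<open>A vertex of fibre \<open>Suc e\<close> has two neighbours in fibre \<open>e\<close>,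
  both with the same \<open>q\<close>. Every other vertex has equally many with either
  \<open>q\<close>, so the signs cancel.\<close>

lemma sum_adj_left_end:
  assumes "Suc e < n"
  shows "(\<Sum>z\<in>verts n. of_bool (adj n X x z) * left_end e z)
    = (if e \<in> X then -2 else 2) * right_end e x"
  using assms by (subst sum_fibre[of _ e]) (cases x; auto)+

lemma sum_adj_right_end:
  assumes "Suc e < n"
  shows "(\<Sum>z\<in>verts n. of_bool (adj n X x z) * right_end e z)
    = (if e \<in> X then -2 else 2) * left_end e x"
  using assms by (subst sum_fibre[of _ "Suc e"]) (cases x; auto)+

lemma sum_ends:
  assumes "Suc e < n"
  shows "(\<Sum>z\<in>verts n. left_end e z * left_end e z) = 4"
    and "(\<Sum>z\<in>verts n. right_end e z * right_end e z) = 4"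
    and "(\<Sum>z\<in>verts n. left_end e z * right_end e z) = 0"
proof -
  show "(\<Sum>z\<in>verts n. left_end e z * left_end e z) = 4"
    using assms by (subst sum_fibre[of _ e]) auto
  show "(\<Sum>z\<in>verts n. right_end e z * right_end e z) = 4"
    using assms by (subst sum_fibre[of _ "Suc e"]) auto
  show "(\<Sum>z\<in>verts n. left_end e z * right_end e z) = 0"
    using assms by (subst sum_fibre[of _ e]) auto
qed

text \<open>Since \<open>of_bool (q = p) - sgn_of q * sgn_of p\<close> is
  \<open>of_bool (q \<noteq> p)\<close>, a twist is a switching by the two characters. The last two
  hypotheses keep \<open>x\<close> and \<open>y\<close> from lying at opposite ends of the
  link.\<close>

lemma walks_on_insert_twist:
  assumes e: "Suc e < n" "e \<notin> X" and "x \<in> verts n" "y \<in> verts n"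
    and "left_end e x * right_end e y = 0" and "right_end e x * left_end e y = 0"
  shows "walks_on (verts n) (adj n (insert e X)) k x y = walks_on (verts n) (adj n X) k x y"
proof -
  have "int (walks_on (verts n) (adj n (insert e X)) k x y)
      = int (walks_on (verts n) (adj n X) k x y)
        - (if odd k then 2 ^ (k - 1) * (left_end e x * right_end e y + right_end e x * left_end e y) else 0)"
  proof (rule walks_on_switching)
    show "of_bool (adj n (insert e X) x z)
        = of_bool (adj n X x z) - (left_end e x * right_end e z + right_end e x * left_end e z)" for x z
      using e by (cases x; cases z) auto
  qed (use assms symp_adj in \<open>auto simp: sum_adj_left_end sum_adj_right_end sum_ends\<close>)
  then show ?thesis unfolding assms(5,6) by (simp split: if_splits)
qed

section \<open>Flipping fibres, which toggles twists\<close>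

fun flip :: "nat set \<Rightarrow> vertex \<Rightarrow> vertex" where
  "flip F (P j p q) = (if j \<in> F then P j (\<not> p) (\<not> q) else P j p q)"
| "flip F x = x"

lemma flip_flip [simp]: "flip F (flip F x) = x"
  by (cases x) auto

lemma flip_in_verts [simp]: "flip F x \<in> verts n \<longleftrightarrow> x \<in> verts n"
  by (cases x) auto

lemma bij_betw_flip: "bij_betw (flip F) (verts n) (verts n)"
  by (rule bij_betw_byWitness[where f' = "flip F"]) auto

text \<open>Complementing both coordinates preserves \<open>p \<noteq> q\<close> and toggles each
  link with exactly one end in \<open>F\<close>. End fibres are excluded because \<open>S\<close>
  sees their outer coordinates.\<close>

lemma walks_on_flip:
  assumes F: "0 \<notin> F" "n - 1 \<notin> F"
    and X: "\<And>j. j \<in> X' \<longleftrightarrow> (j \<in> X) \<noteq> ((j \<in> F) \<noteq> (Suc j \<in> F))"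
    and "x \<in> verts n" "y \<in> verts n"
  shows "walks_on (verts n) (adj n X') k (flip F x) (flip F y) = walks_on (verts n) (adj n X) k x y"
proof (rule walks_on_iso[OF bij_betw_flip])
  fix x y
  show "adj n X x y \<longleftrightarrow> adj n X' (flip F x) (flip F y)"
    using F by (cases x; cases y) (auto simp: X)
qed (use assms in auto)


lemma wstar_on_cong:
  "(\<And>k. walks_on V R k x y = walks_on V R' k x' y') \<Longrightarrow> wstar_on V R x y = wstar_on V R' x' y'"
  by (simp add: wstar_on_def)

subsection \<open>Equality up to round \<open>r\<close>\<close>

text \<open>
  Flipping the fibres \<open>j - 1, j, j + 1\<close> is an isomorphism onto the graph twisted at the links
  \<open>j - 2\<close> and \<open>j + 1\<close>, neither of which walks starting in fibre \<open>j\<close> can detect.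
\<close>

lemma omega_on_flip_untwisted:
  assumes "s < j" and "j + s < Suc (2 * r)"
  shows "omega_on s (verts (2 * r + 2)) (adj (2 * r + 2) {}) (P j p q)
       = omega_on s (verts (2 * r + 2)) (adj (2 * r + 2) {}) (P j (\<not> p) (\<not> q))"
  using assms
proof (induction s arbitrary: j p q)
  case 0
  let ?n = "2 * r + 2"
  \<comment> \<open>Flipping fibre \<open>j\<close> alone twists both links at \<open>j\<close>;
    closed walks miss this, as no vertex lies at both ends of a link.\<close>
  obtain i where i: "j = Suc i" using 0 by (cases j) auto
  have "walks_on (verts ?n) (adj ?n {}) k (P j p q) (P j p q)
      = walks_on (verts ?n) (adj ?n {}) k (P j (\<not> p) (\<not> q)) (P j (\<not> p) (\<not> q))" for k
  proof -
    have "walks_on (verts ?n) (adj ?n {}) k (P j p q) (P j p q)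
        = walks_on (verts ?n) (adj ?n {i, j}) k (flip {j} (P j p q)) (flip {j} (P j p q))"
      using 0 i by (intro walks_on_flip[symmetric]) auto
    also have "\<dots> = walks_on (verts ?n) (adj ?n {j}) k (flip {j} (P j p q)) (flip {j} (P j p q))"
      using 0 i by (intro walks_on_insert_twist) auto
    also have "\<dots> = walks_on (verts ?n) (adj ?n {}) k (flip {j} (P j p q)) (flip {j} (P j p q))"
      using 0 i by (intro walks_on_insert_twist) auto
    finally show ?thesis by simp
  qed
  then show ?case by (auto intro: wstar_on_cong)
next
  case (Suc s)
  let ?n = "2 * r + 2"
  obtain i where i: "j = Suc (Suc i)" using Suc.prems by (cases j; cases "j - 1") auto
  define F where "F = {Suc i, j, Suc j}"
  have w: "walks_on (verts ?n) (adj ?n {}) k (P j p q) y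
      = walks_on (verts ?n) (adj ?n {}) k (P j (\<not> p) (\<not> q)) (flip F y)" if "y \<in> verts ?n" for k y
  proof -
    have "walks_on (verts ?n) (adj ?n {}) k (P j p q) y
        = walks_on (verts ?n) (adj ?n {i, Suc j}) k (flip F (P j p q)) (flip F y)"
      using Suc.prems i that by (intro walks_on_flip[symmetric]) (auto simp: F_def)
    also have "\<dots> = walks_on (verts ?n) (adj ?n {Suc j}) k (flip F (P j p q)) (flip F y)"
      using Suc.prems i that by (intro walks_on_insert_twist) (auto simp: F_def)
    also have "\<dots> = walks_on (verts ?n) (adj ?n {}) k (flip F (P j p q)) (flip F y)"
      using Suc.prems i that by (intro walks_on_insert_twist) (auto simp: F_def)
    finally show ?thesis by (simp add: F_def)
  qed
  \<comment> \<open>Passing from \<open>Suc s\<close> to \<open>s\<close> widens the admissible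
    range of fibres by one on each side, which covers all of \<open>F\<close>.\<close>
  have o: "omega_on s (verts ?n) (adj ?n {}) y = omega_on s (verts ?n) (adj ?n {}) (flip F y)" for y
  proof (cases y)
    case (P j' p' q')
    then show ?thesis
      using Suc.prems i Suc.IH[of j' p' q'] by (auto simp: F_def)
  qed auto
  show ?case
    using Suc.IH[of j p q] Suc.prems
    by (auto intro!: image_mset_bij[OF bij_betw_flip[of F]] wstar_on_cong w o)
qed

text \<open>
  For \<open>x\<close> at one end of the twisted link, flipping the fibre at the other end restores the walk
  counts from \<open>x\<close>, and the previous lemma says that round \<open>s < r\<close> does not see this flip.
\<close>

lemma omega_on_twist:
  assumes "1 \<le> r" and "s \<le> r" and "x \<in> verts (2 * r + 2)"
  shows "omega_on s (verts (2 * r + 2)) (adj (2 * r + 2) {}) x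
       = omega_on s (verts (2 * r + 2)) (adj (2 * r + 2) {r}) x"
  using assms(2,3)
proof (induction s arbitrary: x)
  case 0
  have "left_end r x * right_end r x = 0" by (cases x) auto
  with 0 show ?case
    by (auto intro!: wstar_on_cong walks_on_insert_twist[symmetric] simp: mult.commute)
next
  case (Suc s)
  let ?n = "2 * r + 2"
  have "\<exists>F. F \<subseteq> {r, Suc r} \<and> (\<forall>k. \<forall>y \<in> verts ?n. walks_on (verts ?n) (adj ?n {}) k x y
      = walks_on (verts ?n) (adj ?n {r}) k x (flip F y))"
  proof -
    consider (left) p q where "x = P r p q" | (right) p q where "x = P (Suc r) p q"
      | (other) "left_end r x = 0" "right_end r x = 0"
      by (cases x; cases "left_end r x = 0"; cases "right_end r x = 0") (auto split: if_splits)
    then show ?thesis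
    proof cases
      case left
      \<comment> \<open>The flip twists the links \<open>r\<close> and \<open>Suc r\<close>, and the
        latter does not touch fibre \<open>r\<close>. By \<open>1 \<le> r\<close>, fibre
        \<open>Suc r\<close> is not the last one.\<close>
      have "walks_on (verts ?n) (adj ?n {}) k x y
          = walks_on (verts ?n) (adj ?n {r}) k x (flip {Suc r} y)" if "y \<in> verts ?n" for k y
      proof -
        have "walks_on (verts ?n) (adj ?n {}) k x y
            = walks_on (verts ?n) (adj ?n {Suc r, r}) k (flip {Suc r} x) (flip {Suc r} y)"
          using assms(1) left that by (intro walks_on_flip[symmetric]) auto
        also have "\<dots> = walks_on (verts ?n) (adj ?n {r}) k (flip {Suc r} x) (flip {Suc r} y)"
          using assms(1) left that by (intro walks_on_insert_twist) auto
        finally show ?thesis using left by simp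
      qed
      then show ?thesis by (intro exI[of _ "{Suc r}"]) auto
    next
      case right
      obtain i where i: "r = Suc i" using assms(1) by (cases r) auto
      have "walks_on (verts ?n) (adj ?n {}) k x y
          = walks_on (verts ?n) (adj ?n {r}) k x (flip {r} y)" if "y \<in> verts ?n" for k y
      proof -
        have "walks_on (verts ?n) (adj ?n {}) k x y
            = walks_on (verts ?n) (adj ?n {i, r}) k (flip {r} x) (flip {r} y)"
          using i right that by (intro walks_on_flip[symmetric]) auto
        also have "\<dots> = walks_on (verts ?n) (adj ?n {r}) k (flip {r} x) (flip {r} y)"
          using i right that by (intro walks_on_insert_twist) auto
        finally show ?thesis using right by simp
      qed
      then show ?thesis by (intro exI[of _ "{r}"]) auto
    next
      case other
      have "flip {} y = y" for y by (cases y) auto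
      with other Suc.prems show ?thesis
        by (intro exI[of _ "{}"]) (auto intro!: walks_on_insert_twist[symmetric])
    qed
  qed
  then obtain F where F: "F \<subseteq> {r, Suc r}"
    and w: "\<And>k y. y \<in> verts ?n \<Longrightarrow> walks_on (verts ?n) (adj ?n {}) k x y
      = walks_on (verts ?n) (adj ?n {r}) k x (flip F y)" by blast
  have o: "omega_on s (verts ?n) (adj ?n {}) y = omega_on s (verts ?n) (adj ?n {r}) (flip F y)"
    if y: "y \<in> verts ?n" for y
  proof -
    have "omega_on s (verts ?n) (adj ?n {}) y = omega_on s (verts ?n) (adj ?n {}) (flip F y)"
    proof (cases y)
      case (P j p q)
      show ?thesis
      proof (cases "j \<in> F")
        case True
        with F have "j = r \<or> j = Suc r" by blast
        \<comment> \<open>For either end of the link both bounds together amount to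
          \<open>s < r\<close>.\<close>
        then have "s < j" "j + s < Suc (2 * r)" using Suc.prems by auto
        then show ?thesis
          using omega_on_flip_untwisted[of s j r p q] P True by simp
      qed (use P in auto)
    qed auto
    with Suc y show ?thesis by simp
  qed
  show ?case
    using Suc by (auto intro!: image_mset_bij[OF bij_betw_flip[of F]] wstar_on_cong w o)
qed

subsection \<open>Separation at round \<open>r + 1\<close>\<close>

text \<open>Closed walks of length 2 count neighbours, so entry 2 is the degree.\<close>

primrec root_degree :: "wcol \<Rightarrow> nat" where
  "root_degree (W0 l) = l ! 2"
| "root_degree (WS c M) = root_degree c"

text \<open>Entry 1 of a walk list records adjacency, so this applies the adjacency matrix to
  \<open>h\<close> of the previous round, using the colour alone.\<close>

definition nbr_sum :: "(wcol \<Rightarrow> int) \<Rightarrow> wcol \<Rightarrow> int" where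
  "nbr_sum h c = (case c of W0 l \<Rightarrow> 0
     | WS c' M \<Rightarrow> \<Sum>\<^sub># (image_mset (\<lambda>(l, d). of_bool (l ! 1 = 1) * h d) M))"

text \<open>
  On the first fibre, degrees 2, 4 versus 3 encode \<open>(-1)\<^sup>q\<close>; degree 6 encodes
  \<open>p \<noteq> q\<close> on inner fibres. Hence the signal is a multiple of \<open>(-1)\<^sup>q\<close> on fibre \<open>s\<close> and, symmetrically,
  of \<open>(-1)\<^sup>p\<close> on fibre \<open>2r + 1 - s\<close>, and it vanishes elsewhere.
\<close>

primrec signal :: "nat \<Rightarrow> wcol \<Rightarrow> int" where
  "signal 0 c = (if root_degree c \<in> {2, 4} then 1 else if root_degree c = 3 then -1 else 0)"
| "signal (Suc s) c = (if root_degree c = 6 then -1 else 1) * nbr_sum (signal s) c"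

lemma walks_on_one:
  assumes "finite V" and "y \<in> V"
  shows "walks_on V R (Suc 0) x y = of_bool (R x y)"
proof -
  have "walks_on V R (Suc 0) x y = (\<Sum>z\<in>V. if z = y then of_bool (R x y) else 0)"
    unfolding walks_on.simps by (rule sum.cong) auto
  then show ?thesis using assms by simp
qed

lemma nbr_sum_omega_on:
  assumes "finite V" and "2 \<le> card V" and "x \<in> V"
  shows "nbr_sum h (omega_on (Suc s) V R x) = (\<Sum>y\<in>V. of_bool (R x y) * h (omega_on s V R y))"
  using assms
  by (auto simp: walks_on_one nbr_sum_def multiset.map_comp comp_def wstar_on_def
      sum_unfold_sum_mset[symmetric] simp del: walks_on.simps intro!: sum.cong)

lemma root_degree_omega_on:
  assumes "finite V" and "3 \<le> card V" and "x \<in> V" and "symp R"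
  shows "int (root_degree (omega_on s V R x)) = (\<Sum>y\<in>V. of_bool (R x y))"
proof -
  have "walks_on V R (Suc 0) z x = of_bool (R z x)" for z
    using assms by (simp add: walks_on_one del: walks_on.simps)
  then have "int (walks_on V R (Suc (Suc 0)) x x) = (\<Sum>y\<in>V. of_bool (R x y))"
    using assms(4) by (auto simp: walks_on_int_Suc[of V R "Suc 0"] simp del: walks_on.simps
        intro!: sum.cong dest: sympD)
  with assms(2) have "int (root_degree (omega_on 0 V R x)) = (\<Sum>y\<in>V. of_bool (R x y))"
    by (simp add: wstar_on_def numeral_2_eq_2 del: walks_on.simps)
  moreover have "root_degree (omega_on s V R x) = root_degree (omega_on 0 V R x)"
    by (induction s) simp_all
  ultimately show ?thesis by simp
qed

lemma degree_fibre:
  assumes "j < n" and "2 \<le> n"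
  shows "(\<Sum>z\<in>verts n. of_bool (adj n X (P j p q) z) :: int)
    = (if j = 0 then 2 + of_bool p + of_bool (p \<noteq> q)
       else if Suc j = n then 2 + of_bool q + of_bool (p \<noteq> q)
       else 5 + of_bool (p \<noteq> q))"
proof -
  have "(\<Sum>i<n. of_bool (adj n X (P j p q) (P i False False)) + of_bool (adj n X (P j p q) (P i False True))
      + of_bool (adj n X (P j p q) (P i True False)) + of_bool (adj n X (P j p q) (P i True True)) :: int)
    = (\<Sum>i<n. (if i = Suc j then 2 else 0) + (if i = j - 1 then (if j = 0 then 0 else 2) else 0))"
    using assms by (intro sum.cong) auto
  also have "\<dots> = (if Suc j < n then 2 else 0) + (if j = 0 then 0 else 2)"
    using assms by (auto simp: sum.distrib)
  finally show ?thesis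
    using assms by (auto simp: sum_verts)
qed

text \<open>Keeps the hubs away from the degrees 2, 3, 4 of the end fibres, so that the initial
  signal vanishes on them.\<close>

lemma degree_hub:
  assumes "4 \<le> n" and "x \<in> {S, T, Z}"
  shows "(\<Sum>z\<in>verts n. of_bool (adj n X x z) :: int) \<ge> 5"
proof -
  have S: "(\<Sum>i<n. of_bool (adj n X S (P i False False)) + of_bool (adj n X S (P i False True))
      + of_bool (adj n X S (P i True False)) + of_bool (adj n X S (P i True True)) :: int)
    = (\<Sum>i<n. (if i = 0 then 2 else 0) + (if i = n - 1 then 2 else 0))"
    using assms by (intro sum.cong) auto
  have Z: "(\<Sum>i<n. of_bool (0 < i \<and> Suc i < n) :: int) \<ge> (\<Sum>i\<in>{1,2}. of_bool (0 < i \<and> Suc i < n))"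
    using assms by (intro sum_mono2) auto
  show ?thesis
    using assms S Z by (auto simp: sum_verts sum.distrib)
qed

text \<open>The neighbour sum carries \<open>left_end s\<close> to \<open>2 * right_end s\<close>, a
  character in \<open>p\<close> on fibre \<open>Suc s\<close>; the sign read from degree 6 turns it
  into one in \<open>q\<close>, namely \<open>left_end (Suc s)\<close>. The other front moves
  symmetrically.\<close>

lemma signal_omega_on:
  assumes "1 \<le> r" and "X \<subseteq> {r}" and "s \<le> r" and "x \<in> verts (2 * r + 2)"
  shows "signal s (omega_on s (verts (2 * r + 2)) (adj (2 * r + 2) X) x)
       = 2 ^ s * (left_end s x + right_end (2 * r - s) x)"
  using assms(3,4)
proof (induction s arbitrary: x)
  case 0
  let ?d = "root_degree (omega_on 0 (verts (2 * r + 2)) (adj (2 * r + 2) X) x)"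
  have d: "int ?d = (\<Sum>z\<in>verts (2 * r + 2). of_bool (adj (2 * r + 2) X x z))"
    using 0 by (intro root_degree_omega_on) (auto simp: card_verts symp_adj)
  show ?case
  proof (cases x)
    case (P j p q)
    have "int ?d = (if j = 0 then 2 + of_bool p + of_bool (p \<noteq> q)
       else if Suc j = 2 * r + 2 then 2 + of_bool q + of_bool (p \<noteq> q)
       else 5 + of_bool (p \<noteq> q))"
      unfolding d using P 0 assms(1) by (subst P, subst degree_fibre) auto
    then have "?d = (if j = 0 then 2 + of_bool p + of_bool (p \<noteq> q)
       else if Suc j = 2 * r + 2 then 2 + of_bool q + of_bool (p \<noteq> q)
       else 5 + of_bool (p \<noteq> q))"
      by (auto split: if_splits)
    then show ?thesis
      using P by (auto simp del: omega_on.simps)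
  next
    case S
    then show ?thesis using d degree_hub[of "2 * r + 2" x X] assms(1) by (auto simp del: omega_on.simps)
  next
    case T
    then show ?thesis using d degree_hub[of "2 * r + 2" x X] assms(1) by (auto simp del: omega_on.simps)
  next
    case Z
    then show ?thesis using d degree_hub[of "2 * r + 2" x X] assms(1) by (auto simp del: omega_on.simps)
  qed
next
  case (Suc s)
  let ?n = "2 * r + 2"
  let ?d = "root_degree (omega_on (Suc s) (verts ?n) (adj ?n X) x)"
  \<comment> \<open>The fronts cross the links \<open>s\<close> and \<open>2 * r - s\<close>, which
    differ from \<open>r\<close> as long as \<open>s < r\<close>.\<close>
  have X: "s \<notin> X" "2 * r - s \<notin> X" using assms(2) Suc.prems by auto
  have d: "int ?d = (\<Sum>z\<in>verts ?n. of_bool (adj ?n X x z))"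
    using Suc.prems by (intro root_degree_omega_on) (auto simp: card_verts symp_adj)
  have "nbr_sum (signal s) (omega_on (Suc s) (verts ?n) (adj ?n X) x)
      = (\<Sum>z\<in>verts ?n. of_bool (adj ?n X x z) * (2 ^ s * (left_end s z + right_end (2 * r - s) z)))"
    using Suc by (subst nbr_sum_omega_on) (auto simp: card_verts intro!: sum.cong)
  also have "\<dots> = 2 ^ s * ((\<Sum>z\<in>verts ?n. of_bool (adj ?n X x z) * left_end s z)
      + (\<Sum>z\<in>verts ?n. of_bool (adj ?n X x z) * right_end (2 * r - s) z))"
    unfolding sum_distrib_left sum.distrib[symmetric] by (simp add: algebra_simps)
  also have "\<dots> = 2 ^ Suc s * (right_end s x + left_end (2 * r - s) x)"
    using Suc.prems X by (simp add: sum_adj_left_end sum_adj_right_end)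
  finally have nbr: "nbr_sum (signal s) (omega_on (Suc s) (verts ?n) (adj ?n X) x)
      = 2 ^ Suc s * (right_end s x + left_end (2 * r - s) x)" .
  have sign: "(if ?d = 6 then -1 else 1) * (right_end s x + left_end (2 * r - s) x)
      = left_end (Suc s) x + right_end (2 * r - Suc s) x"
  proof (cases x)
    case (P j p q)
    have "int ?d = 5 + of_bool (p \<noteq> q)" if "j = Suc s \<or> j = 2 * r - s"
      unfolding d using that P Suc.prems assms(1) by (subst P, subst degree_fibre) auto
    then have deg: "?d = 6 \<longleftrightarrow> p \<noteq> q" if "j = Suc s \<or> j = 2 * r - s"
      using that by (cases "p = q") (auto simp del: omega_on.simps)
    have ne: "Suc s \<noteq> 2 * r - s" and eq: "Suc (2 * r - Suc s) = 2 * r - s"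
      using Suc.prems by presburger+
    consider "j = Suc s" | "j = 2 * r - s" | "j \<noteq> Suc s" "j \<noteq> 2 * r - s" by blast
    then show ?thesis
    proof cases
      case 1
      with deg[unfolded P] ne show ?thesis unfolding P by (simp add: eq del: omega_on.simps)
    next
      case 2
      with deg[unfolded P] ne show ?thesis unfolding P by (simp add: eq del: omega_on.simps)
    next
      case 3
      then show ?thesis unfolding P by (simp add: eq)
    qed
  qed auto
  have "signal (Suc s) (omega_on (Suc s) (verts ?n) (adj ?n X) x)
      = 2 ^ Suc s * ((if ?d = 6 then -1 else 1) * (right_end s x + left_end (2 * r - s) x))"
    unfolding signal.simps nbr by (rule mult.left_commute)
  then show ?case unfolding sign .
qed

text \<open>In round \<open>r\<close> the fronts occupy both ends of link \<open>r\<close>. There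
  the signal is an eigenvector with eigenvalue 2 or -2, according to the twist, and this quadratic
  form exposes the sign.\<close>

lemma sum_signal_final:
  assumes "1 \<le> r" and "X \<subseteq> {r}"
  defines "V \<equiv> verts (2 * r + 2)" and "R \<equiv> adj (2 * r + 2) X"
  shows "(\<Sum>x\<in>V. signal r (omega_on r V R x) * nbr_sum (signal r) (omega_on (Suc r) V R x))
    = (if r \<in> X then -1 else 1) * 2 ^ (2 * r + 4)"
proof -
  have e: "Suc r < 2 * r + 2" by simp
  have V_finite: "finite V" and V_card: "2 \<le> card V" by (simp_all add: V_def card_verts)
  define c :: int where "c = (if r \<in> X then -2 else 2)"
  have sig: "signal r (omega_on r V R x) = 2 ^ r * (left_end r x + right_end r x)" if "x \<in> V" for x
    using signal_omega_on[of r X r x] assms that by simp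
  have nbr: "nbr_sum (signal r) (omega_on (Suc r) V R x) = 2 ^ r * c * (left_end r x + right_end r x)"
    if "x \<in> V" for x
  proof -
    have "nbr_sum (signal r) (omega_on (Suc r) V R x)
        = (\<Sum>z\<in>V. of_bool (R x z) * (2 ^ r * (left_end r z + right_end r z)))"
      using that by (subst nbr_sum_omega_on) (auto simp: card_verts sig V_finite V_card intro!: sum.cong)
    also have "\<dots> = 2 ^ r * ((\<Sum>z\<in>V. of_bool (R x z) * left_end r z)
        + (\<Sum>z\<in>V. of_bool (R x z) * right_end r z))"
      unfolding sum_distrib_left sum.distrib[symmetric] by (simp add: algebra_simps)
    also have "\<dots> = 2 ^ r * c * (left_end r x + right_end r x)"
      unfolding V_def R_def sum_adj_left_end[OF e] sum_adj_right_end[OF e] c_def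
      by (simp add: algebra_simps)
    finally show ?thesis .
  qed
  have "(\<Sum>x\<in>V. signal r (omega_on r V R x) * nbr_sum (signal r) (omega_on (Suc r) V R x))
      = (\<Sum>x\<in>V. 2 ^ r * (left_end r x + right_end r x) * (2 ^ r * c * (left_end r x + right_end r x)))"
    by (intro sum.cong) (simp_all add: sig nbr del: omega_on.simps)
  also have "\<dots> = 2 ^ r * 2 ^ r * c * ((\<Sum>x\<in>V. left_end r x * left_end r x)
      + (\<Sum>x\<in>V. right_end r x * right_end r x) + 2 * (\<Sum>x\<in>V. left_end r x * right_end r x))"
    unfolding sum_distrib_left sum.distrib[symmetric]
    by (intro sum.cong) (simp_all add: algebra_simps)
  also have "\<dots> = (if r \<in> X then -1 else 1) * 2 ^ (2 * r + 4)"
    unfolding V_def sum_ends[OF e] c_def by (simp add: power_add power_even_eq power2_eq_square)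
  finally show ?thesis .
qed

lemma omega_on_Suc_twist_neq:
  assumes "1 \<le> r"
  defines "V \<equiv> verts (2 * r + 2)"
  shows "image_mset (omega_on (Suc r) V (adj (2 * r + 2) {})) (mset_set V)
       \<noteq> image_mset (omega_on (Suc r) V (adj (2 * r + 2) {r})) (mset_set V)"
proof
  \<comment> \<open>The summand of the quadratic form depends only on the colour of round
    \<open>Suc r\<close>, so equal multisets would give equal sums.\<close>
  define h where "h c = (case c of W0 l \<Rightarrow> 0 | WS c' M \<Rightarrow> signal r c' * nbr_sum (signal r) c)" for c
  have h: "h (omega_on (Suc r) V R x) = signal r (omega_on r V R x) * nbr_sum (signal r) (omega_on (Suc r) V R x)"
    for R x by (simp add: h_def)
  assume "image_mset (omega_on (Suc r) V (adj (2 * r + 2) {})) (mset_set V)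
       = image_mset (omega_on (Suc r) V (adj (2 * r + 2) {r})) (mset_set V)"
  then have "\<Sum>\<^sub># (image_mset h (image_mset (omega_on (Suc r) V (adj (2 * r + 2) {})) (mset_set V)))
       = \<Sum>\<^sub># (image_mset h (image_mset (omega_on (Suc r) V (adj (2 * r + 2) {r})) (mset_set V)))"
    by (rule arg_cong)
  then have "(\<Sum>x\<in>V. h (omega_on (Suc r) V (adj (2 * r + 2) {}) x))
       = (\<Sum>x\<in>V. h (omega_on (Suc r) V (adj (2 * r + 2) {r}) x))"
    by (simp add: multiset.map_comp comp_def sum_unfold_sum_mset del: omega_on.simps)
  then show False
    unfolding h unfolding V_def using sum_signal_final[of r "{}"] sum_signal_final[of r "{r}"] assms(1)
    by (simp del: omega_on.simps)
qed

lemma omega_strictly_weaker: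
  assumes "1 \<le> r"
  shows "\<exists>N E M F. simple_graph N E \<and> simple_graph M F \<and>
        omega r N E = omega r M F \<and> omega (Suc r) N E \<noteq> omega (Suc r) M F"
proof -
  let ?n = "2 * r + 2"
  obtain E F where "simple_graph (card (verts ?n)) E" and "simple_graph (card (verts ?n)) F"
    and E: "\<And>s. omega s (card (verts ?n)) E = image_mset (omega_on s (verts ?n) (adj ?n {})) (mset_set (verts ?n))"
    and F: "\<And>s. omega s (card (verts ?n)) F = image_mset (omega_on s (verts ?n) (adj ?n {r})) (mset_set (verts ?n))"
    using omega_on_realised[OF finite_verts symp_adj irreflp_adj symp_adj irreflp_adj] by metis
  moreover have "omega r (card (verts ?n)) E = omega r (card (verts ?n)) F"
    unfolding E F using assms by (intro image_mset_cong omega_on_twist) auto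
  moreover have "omega (Suc r) (card (verts ?n)) E \<noteq> omega (Suc r) (card (verts ?n)) F"
    unfolding E F by (rule omega_on_Suc_twist_neq[OF assms])
  ultimately show ?thesis by blast
qed

theorem theorem6p6:
  shows "\<forall>r\<in>{1,2,3::nat}.
     (\<exists>N E M F. simple_graph N E \<and> simple_graph M F \<and>
        omega r N E = omega r M F \<and> omega (Suc r) N E \<noteq> omega (Suc r) M F) \<and>
     (\<forall>N E M F. simple_graph N E \<longrightarrow> simple_graph M F \<longrightarrow>
        omega (Suc r) N E = omega (Suc r) M F \<longrightarrow> omega r N E = omega r M F)"
proof (intro ballI conjI allI impI)
  fix r :: nat
  assume "r \<in> {1, 2, 3}"
  then have "1 \<le> r" by auto
  then show "\<exists>N E M F. simple_graph N E \<and> simple_graph M F \<and>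
      omega r N E = omega r M F \<and> omega (Suc r) N E \<noteq> omega (Suc r) M F"
    by (rule omega_strictly_weaker)
qed (rule omega_Suc_eqD)

end
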